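(* Let $d\ge 2$ and let $A:\mathbb{R}^d\to\mathbb{R}^m$ be a linear map. Let $v^0$ be uniformly distributed on the unit sphere $\mathbb{S}^{d-1}$, let $y^0\sim\mathcal{N}(0,I_d)$ be independent of $v^0$, and set $$x^0=\frac{y^0-\langle y^0,v^0\rangle v^0}{\|y^0-\langle y^0,v^0\rangle v^0\|},\qquad a_0=\langle Av^0,Ax^0\rangle.$$ If $\mathbb{P}(a_0=0)>0$, then $A^*A=cI_d$ for some constant $c\ge 0$.
   Context: $\|\cdot\|$ and $\langle\cdot,\cdot\rangle$ are the standard Euclidean norm and inner product, $A^*$ is the adjoint of $A$, $I_d$ is the identity on $\mathbb{R}^d$, and $\mathbb{S}^{d-1}=\{x\in\mathbb{R}^d\mid\|x\|=1\}$. The vector $x^0$ is almost surely well defined. *)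

theory Defs
  imports "HOL-Probability.Probability"
begin

(* The uniform distribution on the unit sphere, i.e. normalised surface measure, regarded as a
   measure on the whole space. The surface measure of a Borel subset B of the sphere is DIM('a)
   times the Lebesgue measure of the cone {r x | 0 < r < 1, x \<in> B}; normalising it gives the law
   of U / \<parallel>U\<parallel> for U uniform on the open unit ball. *)
definition uniform_sphere :: "'a::euclidean_space measure" where
  "uniform_sphere = distr (uniform_measure lborel (ball 0 1)) borel (\<lambda>x. x /\<^sub>R norm x)"

(* Density of N(0, I) with respect to Lebesgue measure. *)
definition std_gaussian_density :: "'a::euclidean_space \<Rightarrow> real" where
  "std_gaussian_density x = exp (- (norm x)\<^sup>2 / 2) / sqrt (2 * pi) ^ DIM('a)"

lemma emeasure_uniform_sphere:
  fixes B :: "'a::euclidean_space set"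
  assumes "B \<in> sets borel"
  shows "emeasure uniform_sphere B
       = emeasure lborel {x \<in> ball 0 1. x /\<^sub>R norm x \<in> B} / emeasure lborel (ball (0::'a) 1)"
proof -
  have [measurable]: "B \<in> sets borel" by fact
  have m: "(\<lambda>x::'a. x /\<^sub>R norm x) -` B \<in> sets borel"
    using measurable_sets_borel[of "\<lambda>x::'a. x /\<^sub>R norm x" borel B] assms by simp
  have "ball (0::'a) 1 \<inter> ((\<lambda>x. x /\<^sub>R norm x) -` B) = {x \<in> ball 0 1. x /\<^sub>R norm x \<in> B}"
    by auto
  then show ?thesis
    using m by (simp add: uniform_sphere_def emeasure_distr assms emeasure_uniform_measure)
qed

lemma prob_space_uniform_sphere: "prob_space (uniform_sphere :: 'a::euclidean_space measure)"
proof -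
  have "prob_space (uniform_measure lborel (ball (0::'a) 1))"
    using emeasure_lborel_ball_finite[of "0::'a" 1]
    by (intro prob_space_uniform_measure)
       (auto simp: emeasure_ball unit_ball_vol_pos ennreal_eq_0_iff not_le)
  then show ?thesis
    unfolding uniform_sphere_def by (rule prob_space.prob_space_distr) simp
qed

lemma AE_uniform_sphere: "AE x in (uniform_sphere :: 'a::euclidean_space measure). x \<in> sphere 0 1"
proof -
  have "AE x in lborel. x \<noteq> (0::'a)"
    by (rule AE_lborel_singleton)
  then show ?thesis
    unfolding uniform_sphere_def
    by (subst AE_distr_iff) (auto intro!: AE_uniform_measureI elim!: eventually_mono)
qed

(* The wellorder constraint on the index type is inherited from measure_orthogonal_image. *)
lemma uniform_sphere_orthogonal_invariant:
  fixes Q :: "(real, 'n::{finite,wellorder}) vec \<Rightarrow> (real, 'n) vec"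
  assumes Q: "orthogonal_transformation Q"
  shows "distr uniform_sphere borel Q = uniform_sphere"
proof (rule measure_eqI)
  fix B assume "B \<in> sets (distr uniform_sphere borel Q)"
  then have B [measurable]: "B \<in> sets borel" by simp
  have [measurable]: "Q \<in> borel_measurable borel"
    using Q by (intro borel_measurable_continuous_onI linear_continuous_on)
      (simp add: orthogonal_transformation_def linear_conv_bounded_linear)
  let ?C = "\<lambda>B::(real, 'n) vec set. {x \<in> ball 0 1. x /\<^sub>R norm x \<in> B}"
  have lin: "linear Q" and nQ: "norm (Q x) = norm x" and surj: "surj Q" for x
    using Q by (auto simp: orthogonal_transformation orthogonal_transformation_surj)
  have meas: "?C B' \<in> sets lborel" if "B' \<in> sets borel" for B'
  proof -
    have [measurable]: "B' \<in> sets borel" by fact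
    show ?thesis by measurable
  qed
  have QB [measurable]: "Q -` B \<in> sets borel"
    using measurable_sets_borel[of Q borel B] B by simp
  have img: "Q ` ?C (Q -` B) = ?C B"
  proof safe
    fix x assume "x \<in> ball 0 1" "x /\<^sub>R norm x \<in> B"
    moreover obtain z where "x = Q z" using surj by blast
    ultimately show "x \<in> Q ` ?C (Q -` B)"
      by (auto simp: nQ linear_scale[OF lin] intro!: imageI)
  qed (auto simp: nQ linear_scale[OF lin])
  have "bounded (?C (Q -` B))"
    by (rule bounded_subset[OF bounded_ball[of 0 1]]) auto
  then have fin: "?C (Q -` B) \<in> lmeasurable"
    using meas[OF QB] by (intro bounded_set_imp_lmeasurable sets_completionI_sets)
  have fin': "?C B \<in> lmeasurable"
    using measurable_orthogonal_image[OF Q fin] by (simp only: img)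
  have "measure lebesgue (?C B) = measure lebesgue (?C (Q -` B))"
    using measure_orthogonal_image[OF Q fin] by (simp only: img)
  then have "emeasure lebesgue (?C B) = emeasure lebesgue (?C (Q -` B))"
    by (simp only: emeasure_eq_measure2[OF fin] emeasure_eq_measure2[OF fin'])
  then have "emeasure lborel (?C B) = emeasure lborel (?C (Q -` B))"
    using meas[OF B] meas[OF QB] by (simp only: emeasure_completion main_part sets_completionI_sets)
  then have "emeasure uniform_sphere (Q -` B) = emeasure uniform_sphere B"
    by (simp only: emeasure_uniform_sphere[OF B] emeasure_uniform_sphere[OF QB])
  moreover have "Q \<in> measurable uniform_sphere borel" "space uniform_sphere = (UNIV :: (real, 'n) vec set)"
    by (simp_all add: uniform_sphere_def)
  ultimately show "emeasure (distr uniform_sphere borel Q) B = emeasure uniform_sphere B"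
    by (simp add: emeasure_distr)
qed (simp add: uniform_sphere_def)

lemma std_gaussian_density_eq_prod:
  "std_gaussian_density x = (\<Prod>b\<in>Basis. std_normal_density (x \<bullet> b))"
proof -
  have "(norm x)\<^sup>2 = (\<Sum>b\<in>Basis. (x \<bullet> b)\<^sup>2)"
    unfolding power2_norm_eq_inner by (subst euclidean_inner) (simp add: power2_eq_square)
  then show ?thesis
    by (simp add: std_gaussian_density_def std_normal_density_def prod.distrib exp_sum[symmetric]
        sum_negf sum_divide_distrib[symmetric] power_one_over prod_dividef)
qed

lemma prob_space_std_gaussian:
  "prob_space (density lborel (\<lambda>x::'a::euclidean_space. ennreal (std_gaussian_density x)))"
proof
  have 1: "(\<integral>\<^sup>+ t. ennreal (std_normal_density t) \<partial>lborel) = 1"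
    using prob_space.emeasure_space_1[OF prob_space_normal_density[of 1 0]]
    by (simp add: emeasure_density)
  have [measurable]: "(std_gaussian_density :: 'a \<Rightarrow> real) \<in> borel_measurable borel"
    unfolding std_gaussian_density_def[abs_def] by measurable
  have "(\<integral>\<^sup>+ x. ennreal (std_gaussian_density (x::'a)) \<partial>lborel)
      = (\<integral>\<^sup>+ x. (\<Prod>b\<in>Basis. ennreal (std_normal_density (x \<bullet> b))) \<partial>(lborel :: 'a measure))"
    by (simp add: std_gaussian_density_eq_prod prod_ennreal)
  also have "\<dots> = 1"
    by (subst nn_integral_lborel_prod) (auto simp: 1)
  finally show "emeasure (density lborel (\<lambda>x::'a. ennreal (std_gaussian_density x)))
      (space (density lborel (\<lambda>x::'a. ennreal (std_gaussian_density x)))) = 1"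
    by (simp add: emeasure_density)
qed

end

theory Submission
  imports Defs
begin

text \<open>
  Up to the positive factor \<open>1 / \<parallel>y - \<langle>y,v\<rangle>v\<parallel>\<close>, \<open>a\<^sub>0\<close> equals \<open>\<langle>y, Bv - \<langle>Bv,v\<rangle>v\<rangle>\<close> with \<open>B = A\<^sup>*A\<close>. If \<open>v\<close> is not an
  eigenvector of \<open>B\<close>, this vanishes only for \<open>y\<close> in a hyperplane, hence with probability zero.
  So \<open>P(a\<^sub>0 = 0) > 0\<close> forces the eigenvectors of \<open>B\<close> to have positive Lebesgue measure. They form a finite union
  of eigenspaces, one of which is therefore the whole space.
\<close>

text \<open>Eigenvectors for distinct eigenvalues of a symmetric map are orthogonal, and a pairwise
  orthogonal set in a Euclidean space is finite. Choosing one eigenvector \<open>e c\<close> per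
  eigenvalue is injective, so finiteness passes back to the eigenvalues.\<close>

lemma finite_eigenvalues_symmetric:
  fixes B :: "'a::euclidean_space \<Rightarrow> 'a"
  assumes sym: "\<And>x y. B x \<bullet> y = x \<bullet> B y"
  shows "finite {c. \<exists>x. x \<noteq> 0 \<and> B x = c *\<^sub>R x}" (is "finite ?C")
proof -
  obtain e where e: "\<And>c. c \<in> ?C \<Longrightarrow> e c \<noteq> 0 \<and> B (e c) = c *\<^sub>R e c"
    by atomize_elim (rule choice, auto)
  have orth: "e c \<bullet> e c' = 0" if "c \<in> ?C" "c' \<in> ?C" "c \<noteq> c'" for c c'
  proof -
    have "c * (e c \<bullet> e c') = B (e c) \<bullet> e c'" using e[OF that(1)] by simp
    also have "\<dots> = c' * (e c \<bullet> e c')" using e[OF that(2)] by (simp add: sym)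
    finally show ?thesis using that(3) by simp
  qed
  have "inj_on e ?C"
  proof (rule inj_onI, rule ccontr)
    fix c c' assume cc: "c \<in> ?C" "c' \<in> ?C" "e c = e c'" "c \<noteq> c'"
    with orth[OF cc(1,2,4)] e[OF cc(1)] show False by simp
  qed
  moreover have "pairwise orthogonal (e ` ?C)"
    unfolding pairwise_def orthogonal_def using orth by (metis (no_types, lifting) imageE)
  then have "finite (e ` ?C)" by (rule pairwise_orthogonal_imp_finite)
  ultimately show ?thesis using finite_imageD by blast
qed

lemma negligible_eigenvectors_symmetric:
  fixes B :: "'a::euclidean_space \<Rightarrow> 'a"
  assumes lin: "linear B" and sym: "\<And>x y. B x \<bullet> y = x \<bullet> B y"
    and nonscalar: "\<nexists>c. \<forall>x. B x = c *\<^sub>R x"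
  shows "negligible {x. \<exists>c. B x = c *\<^sub>R x}"
proof -
  let ?C = "{c. \<exists>x. x \<noteq> 0 \<and> B x = c *\<^sub>R x}"
  have eigenspace: "negligible {x. B x = c *\<^sub>R x}" (is "negligible ?S") for c
  proof (rule negligible_lowdim)
    have "subspace ?S"
      by (auto simp: subspace_def linear_0[OF lin] linear_add[OF lin] linear_scale[OF lin]
          scaleR_add_right)
    moreover have "?S \<noteq> UNIV" using nonscalar by auto
    ultimately have "dim ?S \<noteq> DIM('a)"
      by (metis dim_eq_full span_eq_iff)
    then show "dim ?S < DIM('a)"
      using dim_subset_UNIV[of ?S] by linarith
  qed
  \<comment> \<open>The zero vector satisfies \<open>B x = c *\<^sub>R x\<close> for every
    \<open>c\<close>, so it is added separately; the union then covers the nonzero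
    eigenvectors.\<close>
  have "{x. \<exists>c. B x = c *\<^sub>R x} \<subseteq> insert 0 (\<Union>c\<in>?C. {x. B x = c *\<^sub>R x})"
    by auto
  moreover have "negligible (insert 0 (\<Union>c\<in>?C. {x. B x = c *\<^sub>R x}))"
    using finite_eigenvalues_symmetric[of B] sym eigenspace
    by (auto intro!: negligible_Union)
  ultimately show ?thesis by (rule negligible_subset[rotated])
qed

text \<open>\<open>negligible\<close> refers to the completed measure, so \<open>S\<close> may fail
  to be Borel; it still lies in a Borel null set.\<close>

lemma AE_lborel_notin_negligible:
  fixes S :: "'a::euclidean_space set"
  assumes "negligible S"
  shows "AE x in lborel. x \<notin> S"
proof -
  have "S \<in> null_sets (completion lborel)"
    using assms by (simp add: negligible_iff_null_sets)
  then have "AE x in completion lborel. x \<notin> S" by (rule AE_not_in)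
  then show ?thesis by (simp add: AE_completion_iff)
qed

text \<open>If the component of \<open>B v\<close> orthogonal to a unit vector \<open>v\<close>
  vanishes, then \<open>v\<close> is an eigenvector. Being an eigenvector is invariant under
  scaling, so the Lebesgue null set of eigenvectors in the ball projects to a null set on the
  sphere.\<close>

lemma AE_uniform_sphere_not_eigenvector:
  fixes B :: "'a::euclidean_space \<Rightarrow> 'a"
  assumes lin: "linear B" and sym: "\<And>x y. B x \<bullet> y = x \<bullet> B y"
    and nonscalar: "\<nexists>c. \<forall>x. B x = c *\<^sub>R x"
  shows "AE v in uniform_sphere. B v - (B v \<bullet> v) *\<^sub>R v \<noteq> 0"
proof -
  have [measurable]: "B \<in> borel_measurable borel"
    using lin by (intro borel_measurable_continuous_onI linear_continuous_on)
      (simp add: linear_conv_bounded_linear)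
  have "AE x in lborel. x \<noteq> (0::'a)" by (rule AE_lborel_singleton)
  moreover have "AE x in lborel. x \<notin> {x. \<exists>c. B x = c *\<^sub>R x}"
    by (intro AE_lborel_notin_negligible negligible_eigenvectors_symmetric assms)
  ultimately have "AE x in lborel. B (x /\<^sub>R norm x) - (B (x /\<^sub>R norm x) \<bullet> (x /\<^sub>R norm x)) *\<^sub>R (x /\<^sub>R norm x) \<noteq> 0"
  proof eventually_elim
    case (elim x)
    show ?case
    proof
      assume "B (x /\<^sub>R norm x) - (B (x /\<^sub>R norm x) \<bullet> (x /\<^sub>R norm x)) *\<^sub>R (x /\<^sub>R norm x) = 0"
      then obtain c where "B (x /\<^sub>R norm x) = c *\<^sub>R (x /\<^sub>R norm x)" by auto
      then have "norm x *\<^sub>R B (x /\<^sub>R norm x) = norm x *\<^sub>R (c *\<^sub>R (x /\<^sub>R norm x))" by simp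
      then have "B x = c *\<^sub>R x" using elim(1) by (simp add: linear_scale[OF lin])
      then show False using elim(2) by auto
    qed
  qed
  then show ?thesis
    unfolding uniform_sphere_def
    by (subst AE_distr_iff) (auto intro!: AE_uniform_measureI elim!: eventually_mono)
qed

text \<open>The Gaussian law has a Lebesgue density, and a hyperplane is Lebesgue null.\<close>

lemma AE_std_gaussian_inner_nonzero:
  fixes u :: "'a::euclidean_space"
  assumes "u \<noteq> 0"
  shows "AE y in density lborel (\<lambda>y. ennreal (std_gaussian_density y)). y \<bullet> u \<noteq> 0"
proof -
  have [measurable]: "(std_gaussian_density :: 'a \<Rightarrow> real) \<in> borel_measurable borel"
    unfolding std_gaussian_density_def[abs_def] by measurable
  have "AE y in lborel. y \<notin> {y. u \<bullet> y = 0}"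
    using assms by (intro AE_lborel_notin_negligible negligible_hyperplane) auto
  then show ?thesis
    by (subst AE_density) (auto simp: inner_commute elim!: eventually_mono)
qed

theorem mainTheorem3:
  fixes A :: "real ^ 'd \<Rightarrow> real ^ 'm"
    and M :: "'w measure"
    and v0 y0 x0 :: "'w \<Rightarrow> real ^ 'd"
    and a0 :: "'w \<Rightarrow> real"
  assumes d_ge_2: "CARD('d) \<ge> 2"
    and linear_A: "linear A"
    and prob_M: "prob_space M"
    and v0_meas: "v0 \<in> borel_measurable M"
    and v0_uniform: "distr M borel v0 = uniform_sphere"
    and y0_normal: "distributed M lborel y0 (\<lambda>y. ennreal (std_gaussian_density y))"
    and indep: "prob_space.indep_var M borel v0 borel y0"
    and x0_def: "\<And>\<omega>. \<omega> \<in> space M \<Longrightarrow>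
      x0 \<omega> = (y0 \<omega> - (y0 \<omega> \<bullet> v0 \<omega>) *\<^sub>R v0 \<omega>) /\<^sub>R norm (y0 \<omega> - (y0 \<omega> \<bullet> v0 \<omega>) *\<^sub>R v0 \<omega>)"
    and a0_def: "\<And>\<omega>. \<omega> \<in> space M \<Longrightarrow> a0 \<omega> = A (v0 \<omega>) \<bullet> A (x0 \<omega>)"
    and pos: "measure M {\<omega> \<in> space M. a0 \<omega> = 0} > 0"
  shows "\<exists>c\<ge>0. adjoint A \<circ> A = (\<lambda>x. c *\<^sub>R x)"
proof -
  interpret prob_space M by (rule prob_M)
  define B where "B = adjoint A \<circ> A"
  have B_inner: "B x \<bullet> y = A x \<bullet> A y" for x y
    by (metis B_def adjoint_works comp_apply inner_commute linear_A)
  have lin: "linear B"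
    unfolding B_def by (intro linear_compose linear_A adjoint_linear)
  have sym: "B x \<bullet> y = x \<bullet> B y" for x y
    by (metis B_inner inner_commute)
  have [measurable]: "B \<in> borel_measurable borel"
    using lin by (intro borel_measurable_continuous_onI linear_continuous_on)
      (simp add: linear_conv_bounded_linear)
  let ?f = "\<lambda>v. B v - (B v \<bullet> v) *\<^sub>R v"
  let ?N = "density lborel (\<lambda>y::real^'d. ennreal (std_gaussian_density y))"
  have y0_meas [measurable]: "y0 \<in> borel_measurable M"
    using distributed_measurable[OF y0_normal] by simp
  note v0_meas [measurable]
  have "distr M lborel y0 = ?N"
    using y0_normal by (rule distributed_distr_eq_density)
  then have y0_distr: "distr M borel y0 = ?N"
    by (metis distr_cong sets_lborel)
  have a0_zero: "y0 \<omega> \<bullet> ?f (v0 \<omega>) = 0" if "\<omega> \<in> space M" "a0 \<omega> = 0" for \<omega>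
  proof -
    define w where "w = y0 \<omega> - (y0 \<omega> \<bullet> v0 \<omega>) *\<^sub>R v0 \<omega>"
    have "B (v0 \<omega>) \<bullet> (w /\<^sub>R norm w) = 0"
      using that a0_def[OF that(1)] x0_def[OF that(1)] by (simp only: w_def B_inner)
    \<comment> \<open>This also covers \<open>w = 0\<close>, where \<open>x0 \<omega>\<close> takes
      the default value 0.\<close>
    then have "B (v0 \<omega>) \<bullet> w = 0"
      by auto
    \<comment> \<open>Projecting off \<open>v0 \<omega>\<close> is self-adjoint, so the projection
      moves from \<open>y0 \<omega>\<close> to \<open>B (v0 \<omega>)\<close>.\<close>
    then show ?thesis
      by (simp add: w_def inner_diff_right inner_commute algebra_simps)
  qed
  have "\<exists>c. \<forall>x. B x = c *\<^sub>R x"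
  proof (rule ccontr)
    assume nonscalar: "\<nexists>c. \<forall>x. B x = c *\<^sub>R x"
    interpret U: prob_space "uniform_sphere :: (real^'d) measure"
      by (rule prob_space_uniform_sphere)
    interpret N: prob_space ?N by (rule prob_space_std_gaussian)
    interpret UN: pair_sigma_finite "uniform_sphere :: (real^'d) measure" ?N ..
    have sets_U [measurable_cong]: "sets (uniform_sphere :: (real^'d) measure) = sets borel"
      by (simp add: uniform_sphere_def)
    \<comment> \<open>Independence makes the joint law a product, so \<open>v\<close> can be frozen
      and \<open>y\<close> treated alone.\<close>
    have joint: "distr M (borel \<Otimes>\<^sub>M borel) (\<lambda>\<omega>. (v0 \<omega>, y0 \<omega>)) = uniform_sphere \<Otimes>\<^sub>M ?N"
      using indep unfolding indep_var_distribution_eq v0_uniform y0_distr by simp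
    have q_meas [measurable]:
      "(\<lambda>p. snd p \<bullet> ?f (fst p)) \<in> borel_measurable (uniform_sphere \<Otimes>\<^sub>M ?N)"
      by measurable
    have "AE v in uniform_sphere. AE y in ?N. y \<bullet> ?f v \<noteq> 0"
      using AE_uniform_sphere_not_eigenvector[OF lin sym nonscalar]
      by eventually_elim (rule AE_std_gaussian_inner_nonzero)
    \<comment> \<open>By Fubini, a measurable set with almost all sections null is null;
      measurability comes from \<open>q_meas\<close>.\<close>
    then have "AE p in uniform_sphere \<Otimes>\<^sub>M ?N. snd p \<bullet> ?f (fst p) \<noteq> 0"
      using measurable_sets[OF q_meas, of "- {0}"]
      by (intro UN.AE_pair_measure) (simp_all add: vimage_def Int_def conj_commute)
    then have "AE \<omega> in M. y0 \<omega> \<bullet> ?f (v0 \<omega>) \<noteq> 0"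
      unfolding joint[symmetric] by (subst (asm) AE_distr_iff) simp_all
    then have "AE \<omega> in M. \<not> a0 \<omega> = 0"
      using AE_space by eventually_elim (use a0_zero in blast)
    then have "emeasure M {\<omega> \<in> space M. a0 \<omega> = 0} = 0"
      by (rule emeasure_eq_0_AE)
    with pos show False by (simp add: measure_def)
  qed
  then obtain c where c: "\<And>x. B x = c *\<^sub>R x" by blast
  obtain b :: "real^'d" where b: "b \<in> Basis" using nonempty_Basis by blast
  \<comment> \<open>For the unit vector \<open>b\<close>, this is the squared norm of
    \<open>A b\<close>.\<close>
  have "c = B b \<bullet> b" using b by (simp add: c)
  then have "c \<ge> 0" by (simp add: B_inner)
  with c show ?thesis unfolding B_def by blast
qed

end
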